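(* Let $b$ be a prime, let $m\ge 1$ be an integer, and let $\mathcal{P}$ be a digital $(0,m,2)$-net in base $b$ that is a NUT net or a NLT net. Then $$\mathrm{disp}(\mathcal{P})\leq \frac{2b}{b^m}\left(1-\frac{b}{2b^m}\right).$$
   Context: Dispersion: let $\mathcal{B}:=\{[x_1,y_1)\times[x_2,y_2)\mid 0\le x_1\le y_1\le 1,\ 0\le x_2\le y_2\le 1\}$. For a finite point set $\mathcal{P}\subset[0,1]^2$, $\mathrm{disp}(\mathcal{P}):=\sup_{B\in\mathcal{B},\,B\cap\mathcal{P}=\emptyset}\lambda(B)$, where $\lambda(B)$ is the area of $B$. Digital nets: let $b$ be a prime, $\mathbb{Z}_b$ the field with $b$ elements, $m\ge 1$, $\phi:\{0,1,\dots,b-1\}\to\mathbb{Z}_b$ a bijection, and $C_1,C_2$ two $m\times m$ matrices over $\mathbb{Z}_b$. For $n\in\{0,1,\dots,b^m-1\}$ with $b$-adic expansion $n=e_1+be_2+\dots+b^{m-1}e_m$, $e_i\in\{0,\dots,b-1\}$, put $\vec n=(\phi(e_1),\dots,\phi(e_m))^\top$, $C_j\vec n=:(y^{(j)}_{n,1},\dots,y^{(j)}_{n,m})^\top$, $x_n^{(j)}=\sum_{i=1}^m \phi^{-1}(y^{(j)}_{n,i})\,b^{-i}$ for $j=1,2$, and $\boldsymbol{x}_n=(x_n^{(1)},x_n^{(2)})$. The digital net generated by $C_1$ and $C_2$ is $\{\boldsymbol{x}_0,\dots,\boldsymbol{x}_{b^m-1}\}$. Let $J_m$ be the $m\times m$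 matrix with entries $1$ on the anti-diagonal (positions $(i,m+1-i)$) and $0$ elsewhere. A NUT net is a digital net generated by $C_1=J_m$ and a nonsingular upper triangular matrix $C_2$ over $\mathbb{Z}_b$; a NLT net is a digital net generated by $C_1=J_m$ and a nonsingular lower triangular matrix $C_2$ over $\mathbb{Z}_b$. A digital $(0,m,2)$-net in base $b$ is a digital net in base $b$ such that every interval $\left[\frac{a_1}{b^{j_1}},\frac{a_1+1}{b^{j_1}}\right)\times\left[\frac{a_2}{b^{j_2}},\frac{a_2+1}{b^{j_2}}\right)$ with integers $j_1,j_2\ge0$, $j_1+j_2=m$, $0\le a_i<b^{j_i}$, contains exactly one of its points; equivalently, for all integers $d_1,d_2\ge 0$ with $d_1+d_2=m$, the first $d_1$ rows of $C_1$ together with the first $d_2$ rows of $C_2$ are linearly independent over $\mathbb{Z}_b$. *)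

theory Defs
  imports
    "HOL-Analysis.Analysis"
    "HOL-Computational_Algebra.Primes"
    "Jordan_Normal_Form.Matrix"
begin

definition boxes :: "(real \<times> real) set set" where
  "boxes = {{x1..<y1} \<times> {x2..<y2} | x1 y1 x2 y2.
      0 \<le> x1 \<and> x1 \<le> y1 \<and> y1 \<le> 1 \<and> 0 \<le> x2 \<and> x2 \<le> y2 \<and> y2 \<le> 1}"

text \<open>The supremum is a genuine one: the empty box is always admissible, and all areas are
  at most 1.\<close>

definition disp :: "(real \<times> real) set \<Rightarrow> real" where
  "disp P = (SUP B \<in> {B \<in> boxes. B \<inter> P = {}}. measure lborel B)"

text \<open>
  The field with \<open>b\<close> elements is represented by a type \<open>'k\<close> of class \<open>field\<close>; that it has
  \<open>b\<close> elements (\<open>CARD('k) = b\<close>), and that \<open>\<phi>\<close> is a bijection from \<open>{..<b}\<close> onto it, is assumed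
  where the notions are used. Vectors and matrices are indexed from 0, so entry \<open>i\<close> of
  \<open>digit_vec b m \<phi> n\<close> belongs to the digit of weight \<open>b ^ i\<close>, and entry \<open>i\<close> of the matrix image
  contributes with weight \<open>1 / b ^ (i + 1)\<close>.\<close>

definition digit_vec :: "nat \<Rightarrow> nat \<Rightarrow> (nat \<Rightarrow> 'k::field) \<Rightarrow> nat \<Rightarrow> 'k Matrix.vec" where
  "digit_vec b m \<phi> n = Matrix.vec m (\<lambda>i. \<phi> (n div b ^ i mod b))"

definition net_coord ::
  "nat \<Rightarrow> nat \<Rightarrow> (nat \<Rightarrow> 'k::field) \<Rightarrow> 'k Matrix.mat \<Rightarrow> nat \<Rightarrow> real" where
  "net_coord b m \<phi> C n =
     (\<Sum>i<m. real (the_inv_into {..<b} \<phi> (vec_index (mult_mat_vec C (digit_vec b m \<phi> n)) i))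
              / real b ^ (i + 1))"

definition digital_net ::
  "nat \<Rightarrow> nat \<Rightarrow> (nat \<Rightarrow> 'k::field) \<Rightarrow> 'k Matrix.mat \<Rightarrow> 'k Matrix.mat \<Rightarrow> (real \<times> real) set" where
  "digital_net b m \<phi> C1 C2 = (\<lambda>n. (net_coord b m \<phi> C1 n, net_coord b m \<phi> C2 n)) ` {..<b ^ m}"

definition J :: "nat \<Rightarrow> 'k::field Matrix.mat" where
  "J m = Matrix.mat m m (\<lambda>(i, j). if i + j + 1 = m then 1 else 0)"

definition lower_triangular :: "'k::zero Matrix.mat \<Rightarrow> bool" where
  "lower_triangular A \<longleftrightarrow>
     (\<forall>i < dim_row A. \<forall>j < dim_col A. i < j \<longrightarrow> index_mat A (i, j) = 0)"

definition NUT_net :: "nat \<Rightarrow> nat \<Rightarrow> (nat \<Rightarrow> 'k::field) \<Rightarrow> (real \<times> real) set \<Rightarrow> bool" where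
  "NUT_net b m \<phi> P \<longleftrightarrow>
     (\<exists>C \<in> carrier_mat m m. invertible_mat C \<and> upper_triangular C \<and> P = digital_net b m \<phi> (J m) C)"

definition NLT_net :: "nat \<Rightarrow> nat \<Rightarrow> (nat \<Rightarrow> 'k::field) \<Rightarrow> (real \<times> real) set \<Rightarrow> bool" where
  "NLT_net b m \<phi> P \<longleftrightarrow>
     (\<exists>C \<in> carrier_mat m m. invertible_mat C \<and> lower_triangular C \<and> P = digital_net b m \<phi> (J m) C)"

definition elementary_interval :: "nat \<Rightarrow> nat \<Rightarrow> nat \<Rightarrow> nat \<Rightarrow> nat \<Rightarrow> (real \<times> real) set" where
  "elementary_interval b j1 j2 a1 a2 =
     {real a1 / real b ^ j1 ..< (real a1 + 1) / real b ^ j1} \<times>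
     {real a2 / real b ^ j2 ..< (real a2 + 1) / real b ^ j2}"

text \<open>Counting elements of the point set \<open>P\<close> agrees with counting indices \<open>n < b ^ m\<close>: for
  \<open>j1 = m\<close> the condition already yields \<open>b ^ m\<close> distinct points.\<close>

definition digital_0m2_net :: "nat \<Rightarrow> nat \<Rightarrow> (nat \<Rightarrow> 'k::field) \<Rightarrow> (real \<times> real) set \<Rightarrow> bool" where
  "digital_0m2_net b m \<phi> P \<longleftrightarrow>
     (\<exists>C1 \<in> carrier_mat m m. \<exists>C2 \<in> carrier_mat m m. P = digital_net b m \<phi> C1 C2) \<and>
     (\<forall>j1 j2 a1 a2. j1 + j2 = m \<longrightarrow> a1 < b ^ j1 \<longrightarrow> a2 < b ^ j2 \<longrightarrow>
        (\<exists>!p. p \<in> P \<and> p \<in> elementary_interval b j1 j2 a1 a2))"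

end

theory Submission
  imports Defs "HOL-Number_Theory.Cong"
begin

text \<open>
  Write \<open>N = b ^ m\<close>. Since the first generating matrix reverses digits, the net consists of the
  points \<open>(n / N, A n / N)\<close> for \<open>n < N\<close>, where \<open>A\<close> is a permutation of \<open>{..<N}\<close>
  (lemmas \<open>digital_net_J\<close> and \<open>coord_numerator_bij\<close>). Lengths are measured in units of \<open>1 / N\<close>.

  Consider the \<open>b ^ j\<close> consecutive columns \<open>n\<close> with a common value of \<open>n div b ^ j\<close>, an
  aligned block. They differ only in their \<open>j\<close> lowest digits, so an upper triangular matrix
  changes only the \<open>j\<close> leading digits of \<open>A n\<close> between them. As \<open>A\<close> is injective, these leading
  digits take every value once: the second coordinates over the block form an arithmetic
  progression of step \<open>b ^ (m - j)\<close> that runs through the whole of \<open>[0, N)\<close>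
  (\<open>block_image_equally_spaced\<close>). An empty box that contains all the columns of the block therefore has
  height below \<open>b ^ (m - j)\<close>. For a lower triangular matrix the same is true of the inverse
  permutation, that is, with the two coordinates exchanged, which does not affect areas.

  A box of width exceeding \<open>2 * b ^ j - 1\<close> contains an aligned block of \<open>b ^ j\<close> columns
  (\<open>interval_contains_aligned_block\<close>). With \<open>j\<close> the largest exponent for which the width of an empty
  box exceeds this threshold, the width is at most \<open>2 * b ^ (j + 1) - 1\<close> and the height at most
  \<open>b ^ (m - j)\<close>, so the area is at most \<open>2 * b * N - b ^ (m - j)\<close>. This is at most
  \<open>2 * b * N - b\<^sup>2\<close>, the claimed bound multiplied by \<open>N\<^sup>2\<close>, as soon as \<open>j \<le> m - 2\<close>; for
  \<open>j = m - 1\<close> the width is at most \<open>N\<close> and the height at most \<open>b\<close>, and \<open>b * N \<le> 2 * b * N - b\<^sup>2\<close>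
  (\<open>empty_box_area_le\<close>). A box of width at most 1, for which there is no such \<open>j\<close>, has area at most
  \<open>N\<close>.
\<close>

section \<open>Numbers read off from digits\<close>

text \<open>The most significant digit is \<open>d 0\<close>: this is the order in which the digits of a net
  coordinate follow the radix point.\<close>

primrec radix_value :: "nat \<Rightarrow> (nat \<Rightarrow> nat) \<Rightarrow> nat \<Rightarrow> nat" where
  "radix_value b d 0 = 0"
| "radix_value b d (Suc k) = b * radix_value b d k + d k"

lemma radix_value_less:
  assumes "\<And>i. i < k \<Longrightarrow> d i < b"
  shows "radix_value b d k < b ^ k"
  using assms
proof (induction k)
  case (Suc k)
  have "radix_value b d k + 1 \<le> b ^ k" "d k < b" using Suc by (auto simp: Suc_le_eq)
  then have "b * (radix_value b d k + 1) \<le> b * b ^ k" by (intro mult_le_mono2)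
  then show ?case using \<open>d k < b\<close> by simp
qed simp

lemma radix_value_cong:
  "(\<And>i. i < k \<Longrightarrow> d i = d' i) \<Longrightarrow> radix_value b d k = radix_value b d' k"
  by (induction k) auto

text \<open>Division by \<open>b ^ j\<close> truncates to the leading digits, and, below, the remainder modulo
  \<open>b ^ j\<close> sees only the trailing \<open>j\<close> digits. These two facts turn triangularity of the matrix
  into arithmetic of coordinates.\<close>

lemma radix_value_div:
  assumes "\<And>i. i < k + j \<Longrightarrow> d i < b"
  shows "radix_value b d (k + j) div b ^ j = radix_value b d k"
  using assms
proof (induction j)
  case (Suc j)
  have "d (k + j) < b" using Suc.prems by simp
  then have "radix_value b d (k + Suc j) div b = radix_value b d (k + j)" by simp
  then have "radix_value b d (k + Suc j) div b ^ Suc j = radix_value b d (k + j) div b ^ j"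
    by (simp only: power_Suc div_mult2_eq)
  then show ?case using Suc by simp
qed simp

lemma radix_value_mod_cong:
  assumes "\<And>i. k \<le> i \<Longrightarrow> i < k + j \<Longrightarrow> d i = d' i"
  shows "radix_value b d (k + j) mod b ^ j = radix_value b d' (k + j) mod b ^ j"
  using assms
proof (induction j)
  case (Suc j)
  have "[radix_value b d (k + j) = radix_value b d' (k + j)] (mod b ^ j)"
    using Suc by (simp add: cong_def)
  then have "[b * radix_value b d (k + j) = b * radix_value b d' (k + j)] (mod b * b ^ j)"
    by (simp add: cong_def flip: mult_mod_right)
  then have "[b * radix_value b d (k + j) + d (k + j) =
      b * radix_value b d' (k + j) + d' (k + j)] (mod b * b ^ j)"
    using Suc.prems by (intro cong_add) auto
  then show ?case by (simp add: cong_def)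
qed simp

lemma radix_value_inj:
  assumes "radix_value b d k = radix_value b d' k"
    and "\<And>i. i < k \<Longrightarrow> d i < b" "\<And>i. i < k \<Longrightarrow> d' i < b" and "i < k"
  shows "d i = d' i"
  using assms
proof (induction k)
  case (Suc k)
  have dk: "d k < b" "d' k < b" using Suc.prems by auto
  have eq: "b * radix_value b d k + d k = b * radix_value b d' k + d' k" using Suc.prems by simp
  have "(b * radix_value b d k + d k) div b = (b * radix_value b d' k + d' k) div b"
    using eq by simp
  then have "radix_value b d k = radix_value b d' k" using dk by simp
  then show ?case using Suc eq by (cases "i = k") auto
qed simp

lemma radix_value_sum:
  assumes "b > 0"
  shows "(\<Sum>i<k. real (d i) / real b ^ (i + 1)) = real (radix_value b d k) / real b ^ k"
  using assms by (induction k) (auto simp: field_simps)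

lemma radix_value_digits:
  assumes "n < b ^ m" and "k \<le> m"
  shows "radix_value b (\<lambda>i. n div b ^ (m - Suc i) mod b) k = n div b ^ (m - k)"
  using assms(2)
proof (induction k)
  case 0
  then show ?case using assms(1) by simp
next
  case (Suc k)
  have "m - k = Suc (m - Suc k)" using Suc.prems by simp
  then have "n div b ^ (m - k) = n div b ^ (m - Suc k) div b"
    by (simp only: \<open>m - k = Suc (m - Suc k)\<close> power_Suc2 div_mult2_eq)
  then show ?case using Suc by simp
qed

lemma digits_determine:
  fixes n n' b m :: nat
  assumes "n < b ^ m" "n' < b ^ m"
    and "\<And>i. i < m \<Longrightarrow> n div b ^ i mod b = n' div b ^ i mod b"
  shows "n = n'"
proof -
  have "radix_value b (\<lambda>i. n div b ^ (m - Suc i) mod b) m =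
      radix_value b (\<lambda>i. n' div b ^ (m - Suc i) mod b) m"
    using assms(3) by (intro radix_value_cong) auto
  then show ?thesis
    using radix_value_digits[OF assms(1), of m] radix_value_digits[OF assms(2), of m] by simp
qed

lemma high_digits_eq:
  fixes n n' b :: nat
  assumes "n div b ^ j = n' div b ^ j" and "j \<le> i"
  shows "n div b ^ i mod b = n' div b ^ i mod b"
proof -
  have "b ^ i = b ^ j * b ^ (i - j)" using assms(2) by (simp flip: power_add)
  then show ?thesis using assms(1) by (simp add: div_mult2_eq)
qed

lemma low_digits_eq:
  fixes n n' b :: nat
  assumes "n mod b ^ k = n' mod b ^ k" and "i < k"
  shows "n div b ^ i mod b = n' div b ^ i mod b"
proof -
  have k: "b ^ k = b ^ i * (b * b ^ (k - Suc i))"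
    using assms(2) power_add[of b i "Suc (k - Suc i)"] by simp
  have "(n mod b ^ k) div b ^ i mod b = n div b ^ i mod b" for n
  proof (cases "b = 0")
    case False
    have "(n mod b ^ k) div b ^ i = n div b ^ i mod (b * b ^ (k - Suc i))"
      unfolding k mod_mult2_eq[of n "b ^ i"] using False by simp
    then show ?thesis by (simp add: mod_mult_right_eq mod_mod_cancel)
  next
    case True
    then show ?thesis using assms(2) by (simp add: zero_power)
  qed
  then show ?thesis using assms(1) by metis
qed

section \<open>Permutations that spread aligned blocks evenly\<close>

text \<open>Only the part of triangularity that matters for empty boxes is kept: on an aligned block
  of \<open>b ^ j\<close> arguments, \<open>f\<close> varies in its \<open>j\<close> leading digits only. The notion does not mention
  matrices, so that it applies to the map from first to second coordinates as well as to its
  inverse.\<close>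

definition spreads_blocks :: "nat \<Rightarrow> nat \<Rightarrow> (nat \<Rightarrow> nat) \<Rightarrow> bool" where
  "spreads_blocks b m f \<longleftrightarrow> bij_betw f {..<b ^ m} {..<b ^ m} \<and>
     (\<forall>j\<le>m. \<forall>n<b ^ m. \<forall>n'<b ^ m.
        n div b ^ j = n' div b ^ j \<longrightarrow> f n mod b ^ (m - j) = f n' mod b ^ (m - j))"

lemma spreads_blocks_bij: "spreads_blocks b m f \<Longrightarrow> bij_betw f {..<b ^ m} {..<b ^ m}"
  unfolding spreads_blocks_def by blast

lemma spreads_blocks_mod_eq:
  "spreads_blocks b m f \<Longrightarrow> j \<le> m \<Longrightarrow> n < b ^ m \<Longrightarrow> n' < b ^ m \<Longrightarrow>
    n div b ^ j = n' div b ^ j \<Longrightarrow> f n mod b ^ (m - j) = f n' mod b ^ (m - j)"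
  unfolding spreads_blocks_def by blast

text \<open>The \<open>b ^ j\<close> values of \<open>f\<close> on a block are distinct and agree modulo \<open>b ^ (m - j)\<close>, so
  their quotients are \<open>b ^ j\<close> distinct numbers below \<open>b ^ j\<close>; by counting, all such numbers
  occur.\<close>

lemma block_image_equally_spaced:
  assumes f: "spreads_blocks b m f" and "b > 0" and j: "j \<le> m" and q: "q < b ^ (m - j)"
  obtains t where "t < b ^ (m - j)"
    and "\<And>i. i < b ^ j \<Longrightarrow> \<exists>n. n < b ^ m \<and> n div b ^ j = q \<and> f n = i * b ^ (m - j) + t"
proof -
  define K where "K = b ^ (m - j)"
  have N: "b ^ m = K * b ^ j" unfolding K_def using j by (simp flip: power_add)
  have K0: "K > 0" and B0: "b ^ j > 0" using \<open>b > 0\<close> by (auto simp: K_def)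
  have blk: "q * b ^ j + r < b ^ m" if "r < b ^ j" for r
  proof -
    have "(q + 1) * b ^ j \<le> K * b ^ j" using q by (intro mult_le_mono1) (auto simp: K_def)
    then show ?thesis using that by (simp add: N)
  qed
  have bij: "bij_betw f {..<b ^ m} {..<b ^ m}" using f by (rule spreads_blocks_bij)
  have same: "f (q * b ^ j + r) mod K = f (q * b ^ j) mod K" if "r < b ^ j" for r
  proof -
    have "(q * b ^ j + r) div b ^ j = (q * b ^ j) div b ^ j" using that B0 by simp
    then show ?thesis
      unfolding K_def using spreads_blocks_mod_eq[OF f j blk[OF that], of "q * b ^ j"] blk[OF B0] by simp
  qed
  define g where "g r = f (q * b ^ j + r) div K" for r
  have "g r < b ^ j" if "r < b ^ j" for r
  proof -
    have "f (q * b ^ j + r) < b ^ m" using bij blk[OF that] by (auto dest: bij_betwE)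
    then show ?thesis unfolding g_def N by (simp add: less_mult_imp_div_less mult.commute)
  qed
  moreover have "inj_on g {..<b ^ j}"
  proof (rule inj_onI)
    fix r s assume rs: "r \<in> {..<b ^ j}" "s \<in> {..<b ^ j}" and "g r = g s"
    then have "f (q * b ^ j + r) = f (q * b ^ j + s)"
      unfolding g_def using same[of r] same[of s] by (metis div_mult_mod_eq lessThan_iff)
    then show "r = s"
      using inj_onD[OF bij_betw_imp_inj_on[OF bij]] blk[of r] blk[of s] rs by fastforce
  qed
  ultimately have surj: "g ` {..<b ^ j} = {..<b ^ j}" by (intro endo_inj_surj) auto
  show ?thesis
  proof (rule that)
    show "f (q * b ^ j) mod K < b ^ (m - j)" using K0 by (simp add: K_def)
    fix i assume "i < b ^ j"
    then obtain r where r: "r < b ^ j" "g r = i" using surj by (metis imageE lessThan_iff)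
    then have "f (q * b ^ j + r) = i * K + f (q * b ^ j) mod K"
      using same[of r] unfolding g_def by (metis div_mult_mod_eq)
    then show "\<exists>n. n < b ^ m \<and> n div b ^ j = q \<and> f n = i * b ^ (m - j) + f (q * b ^ j) mod K"
      using r blk[of r] B0 unfolding K_def by (intro exI[of _ "q * b ^ j + r"]) auto
  qed
qed

section \<open>Empty boxes\<close>

text \<open>A half-open interval as long as the step meets a progression infinite in both
  directions; \<open>0 \<le> x\<close> and \<open>t < K\<close> ensure that the first term from \<open>x\<close> on has a nonnegative
  index.\<close>

lemma progression_hits_interval:
  fixes x y K t :: real
  assumes "K > 0" "t < K" "0 \<le> x" "x + K \<le> y"
  obtains i :: nat where "x \<le> real i * K + t" "real i * K + t < y"
proof -
  define c where "c = \<lceil>(x - t) / K\<rceil>"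
  have "(x - t) / K > -1" using assms by (simp add: field_simps)
  then have c: "c \<ge> 0" unfolding c_def by linarith
  have "(x - t) / K \<le> of_int c" "of_int c < (x - t) / K + 1" unfolding c_def by linarith+
  then have "x - t \<le> of_int c * K" "of_int c * K < x - t + K"
    using assms(1) by (simp_all add: field_simps)
  then show ?thesis using assms c by (intro that[of "nat c"]) auto
qed

text \<open>The first multiple of \<open>B\<close> among the integers from \<open>x\<close> on lies strictly below \<open>x + B\<close>, and
  the block starting there ends \<open>B - 1\<close> later. The threshold \<open>2 * B - 1\<close>, rather than
  \<open>2 * B\<close>, is what produces the second-order term of the final bound.\<close>

lemma interval_contains_aligned_block:
  fixes x y :: real and B M :: nat
  assumes "B > 0" "0 \<le> x" "y \<le> real (M * B)" "y - x > 2 * real B - 1"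
  obtains q where "q < M" and "\<And>n. n div B = q \<Longrightarrow> x \<le> real n \<and> real n < y"
proof -
  define a where "a = nat \<lceil>x\<rceil>"
  define q where "q = (a + B - 1) div B"
  have a: "x \<le> real a" "real a < x + 1" unfolding a_def using assms(2) by linarith+
  have "(a + B - 1) mod B < B" using assms(1) by simp
  moreover have "q * B + (a + B - 1) mod B = a + B - 1" unfolding q_def by simp
  ultimately have qB: "a \<le> q * B" "q * B \<le> a + B - 1" using assms(1) by linarith+
  then have "real (q * B) \<le> real a + real B - 1" using assms(1)
    by (simp flip: of_nat_mult)
  then have top: "real (q * B) + real B - 1 < y" using a assms(4) by linarith
  then have "real (q * B + B) < real (M * B) + 1" using assms(3) by simp
  then have "Suc q * B \<le> M * B" by (simp only: mult_Suc)
  then have "q < M" using assms(1) by (simp only: mult_le_cancel2) simp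
  moreover have "x \<le> real n \<and> real n < y" if "n div B = q" for n
  proof -
    have "q * B + n mod B = n" using that by auto
    moreover have "n mod B < B" using assms(1) by simp
    ultimately have "q * B \<le> n" "n + 1 \<le> q * B + B" by linarith+
    then have "real (q * B) \<le> real n" "real n + 1 \<le> real (q * B) + real B"
      by linarith+
    moreover have "real a \<le> real (q * B)" using qB(1) by (simp only: of_nat_le_iff)
    ultimately show ?thesis using a top by linarith
  qed
  ultimately show ?thesis by (rule that)
qed

text \<open>From here up to \<open>empty_box_area_le\<close>, a box is \<open>[x, y) \<times> [u, v)\<close> in the square scaled to side
  length \<open>b ^ m\<close>, with the points at \<open>(n, f n)\<close>. If the box were at least \<open>b ^ (m - j)\<close> high, it
  would contain a term of the progression formed by the second coordinates over the block of
  columns that it contains.\<close>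

lemma wide_empty_box_low:
  assumes f: "spreads_blocks b m f" and "b > 0" and j: "j \<le> m"
    and x: "0 \<le> x" "y \<le> real (b ^ m)" and u: "0 \<le> u" "v \<le> real (b ^ m)"
    and empty: "\<And>n. n < b ^ m \<Longrightarrow> x \<le> real n \<Longrightarrow> real n < y \<Longrightarrow>
      \<not> (u \<le> real (f n) \<and> real (f n) < v)"
    and wide: "y - x > 2 * real (b ^ j) - 1"
  shows "v - u < real (b ^ (m - j))"
proof (rule ccontr)
  assume "\<not> ?thesis"
  then have tall: "u + real (b ^ (m - j)) \<le> v" by simp
  have N: "b ^ (m - j) * b ^ j = b ^ m" using j by (simp flip: power_add)
  obtain q where q: "q < b ^ (m - j)"
    and blk: "\<And>n. n div b ^ j = q \<Longrightarrow> x \<le> real n \<and> real n < y"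
    using interval_contains_aligned_block[of "b ^ j" x y "b ^ (m - j)"] N \<open>b > 0\<close> x wide
    by (metis zero_less_power)
  obtain t where t: "t < b ^ (m - j)"
    and pt: "\<And>i. i < b ^ j \<Longrightarrow> \<exists>n. n < b ^ m \<and> n div b ^ j = q \<and> f n = i * b ^ (m - j) + t"
    using block_image_equally_spaced[OF f \<open>b > 0\<close> j q] by metis
  obtain i :: nat where i: "u \<le> real i * real (b ^ (m - j)) + real t"
      "real i * real (b ^ (m - j)) + real t < v"
    using progression_hits_interval[of "real (b ^ (m - j))" "real t" u v] t tall u \<open>b > 0\<close>
    by (metis of_nat_0_less_iff of_nat_less_iff zero_less_power)
  have "real (i * b ^ (m - j) + t) < real (b ^ m)" using i(2) u(2) by simp
  then have "i * b ^ (m - j) < b ^ j * b ^ (m - j)"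
    using N by (simp only: of_nat_less_iff mult.commute)
  then have "i < b ^ j" by (simp only: mult_less_cancel2)
  then obtain n where "n < b ^ m" "n div b ^ j = q" "f n = i * b ^ (m - j) + t"
    using pt by blast
  then show False using empty[of n] blk[of n] i by simp
qed

lemma empty_box_area_le:
  assumes f: "spreads_blocks b m f" and b: "b \<ge> 2" and m: "m \<ge> 1"
    and x: "0 \<le> x" "x \<le> y" "y \<le> real (b ^ m)" and u: "0 \<le> u" "u \<le> v" "v \<le> real (b ^ m)"
    and empty: "\<And>n. n < b ^ m \<Longrightarrow> x \<le> real n \<Longrightarrow> real n < y \<Longrightarrow>
      \<not> (u \<le> real (f n) \<and> real (f n) < v)"
  shows "(y - x) * (v - u) \<le> 2 * real b * real b ^ m - real b ^ 2"
proof -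
  let ?N = "real (b ^ m)" and ?b = "real b"
  have "b ^ 1 \<le> b ^ m" using b m by (intro power_increasing) auto
  then have bN: "?b \<le> ?N" by (simp only: of_nat_le_iff power_one_right)
  have b2: "?b \<ge> 2" using b by simp
  have bbN: "?b ^ 2 \<le> ?b * ?N" using bN b2 by (simp add: power2_eq_square mult_left_mono)
  have low: "v - u \<le> real (b ^ (m - j))" if "j \<le> m" "y - x > 2 * real (b ^ j) - 1" for j
    using wide_empty_box_low[OF f _ that(1) x(1,3) u(1,3) empty that(2)] b by simp
  define S where "S = {j. j \<le> m \<and> y - x > 2 * real (b ^ j) - 1}"
  show ?thesis
    \<comment> \<open>The set \<open>S\<close> is empty when the box need not contain a single column, as \<open>j = 0\<close> stands for
      the threshold 1.\<close>
  proof (cases "S = {}")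
    case True
    then have "y - x \<le> 1" unfolding S_def by (force dest: spec[of _ 0])
    then have "(y - x) * (v - u) \<le> 1 * ?N" using x u by (intro mult_mono) auto
    also have "\<dots> \<le> ?b * ?N" using b2 by (intro mult_right_mono) auto
    also have "\<dots> \<le> 2 * ?b * ?N - ?b ^ 2" using bbN by simp
    finally show ?thesis by simp
  next
    case False
    define j where "j = Max S"
    have "finite S" by (rule finite_subset[of _ "{..m}"]) (auto simp: S_def)
    then have "j \<in> S" and max: "\<And>i. i \<in> S \<Longrightarrow> i \<le> j" using False by (auto simp: j_def)
    then have j: "j \<le> m" "y - x > 2 * real (b ^ j) - 1" by (auto simp: S_def)
    have "j \<noteq> m"
    proof
      assume "j = m"
      then have "y - x > 2 * ?N - 1" using j(2) by simp
      then show False using x bN b2 by linarith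
    qed
    then have "j < m" using j(1) by simp
    then have "Suc j \<notin> S" using max by force
    then have w: "y - x \<le> 2 * real (b ^ Suc j) - 1" using \<open>j < m\<close> by (auto simp: S_def)
    have h: "v - u \<le> real (b ^ (m - j))" using low j by blast
    show ?thesis
    proof (cases "Suc j = m")
      case True
      then have "m - j = 1" by simp
      then have "v - u \<le> ?b" using h by simp
      then have "(y - x) * (v - u) \<le> ?N * ?b" using x u by (intro mult_mono) auto
      also have "\<dots> \<le> 2 * ?b * ?N - ?b ^ 2" using bbN by (simp add: algebra_simps)
      finally show ?thesis by simp
    next
      case False
      then have "b ^ 2 \<le> b ^ (m - j)" using \<open>j < m\<close> b by (intro power_increasing) auto
      then have K: "?b ^ 2 \<le> real (b ^ (m - j))" by (simp only: of_nat_le_iff flip: of_nat_power)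
      have N: "real (b ^ j) * real (b ^ (m - j)) = ?N"
        using j(1) by (simp flip: power_add of_nat_mult)
      have "(y - x) * (v - u) \<le> (2 * real (b ^ Suc j) - 1) * real (b ^ (m - j))"
        using w h x u by (intro mult_mono) auto
      also have "\<dots> = 2 * ?b * (real (b ^ j) * real (b ^ (m - j))) - real (b ^ (m - j))"
        by (simp add: algebra_simps)
      also have "\<dots> \<le> 2 * ?b * ?N - ?b ^ 2" using K N by simp
      finally show ?thesis by simp
    qed
  qed
qed

text \<open>Either coordinate may play the part of the argument of \<open>f\<close>, since exchanging the sides of
  a box preserves its area.\<close>

lemma disp_le:
  assumes f: "spreads_blocks b m f" and b: "b \<ge> 2" and m: "m \<ge> 1"
    and P: "P = (\<lambda>n. (real n / real b ^ m, real (f n) / real b ^ m)) ` {..<b ^ m} \<or>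
      P = (\<lambda>n. (real (f n) / real b ^ m, real n / real b ^ m)) ` {..<b ^ m}"
  shows "disp P \<le> 2 * real b / real b ^ m * (1 - real b / (2 * real b ^ m))"
  unfolding disp_def
proof (rule cSUP_least)
  have "{0..<0} \<times> {0..<0} \<in> boxes" unfolding boxes_def by fastforce
  then show "{B \<in> boxes. B \<inter> P = {}} \<noteq> {}" by auto
next
  fix B assume "B \<in> {B \<in> boxes. B \<inter> P = {}}"
  then obtain x y u v where B: "B = {x..<y} \<times> {u..<v}" and BP: "B \<inter> P = {}"
    and xy: "0 \<le> x" "x \<le> y" "y \<le> 1" and uv: "0 \<le> u" "u \<le> v" "v \<le> 1"
    unfolding boxes_def by auto
  let ?N = "real b ^ m"
  have N: "?N > 0" using b by simp
  have sc: "0 \<le> s * ?N" "s * ?N \<le> r * ?N" "r * ?N \<le> real (b ^ m)"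
    if "0 \<le> s" "s \<le> r" "r \<le> 1" for s r
    using that N by auto
  have "((y - x) * (v - u)) * ?N ^ 2 \<le> 2 * real b * ?N - real b ^ 2"
    using P
  proof
    assume P: "P = (\<lambda>n. (real n / ?N, real (f n) / ?N)) ` {..<b ^ m}"
    have "\<not> (u * ?N \<le> real (f n) \<and> real (f n) < v * ?N)"
      if "n < b ^ m" "x * ?N \<le> real n" "real n < y * ?N" for n
    proof
      assume "u * ?N \<le> real (f n) \<and> real (f n) < v * ?N"
      then have "(real n / ?N, real (f n) / ?N) \<in> B \<inter> P"
        using that N by (auto simp: B P field_simps)
      then show False using BP by blast
    qed
    from empty_box_area_le[OF f b m sc[OF xy] sc[OF uv] this] show ?thesis
      by (simp add: algebra_simps power2_eq_square)
  next
    assume P: "P = (\<lambda>n. (real (f n) / ?N, real n / ?N)) ` {..<b ^ m}"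
    have "\<not> (x * ?N \<le> real (f n) \<and> real (f n) < y * ?N)"
      if "n < b ^ m" "u * ?N \<le> real n" "real n < v * ?N" for n
    proof
      assume "x * ?N \<le> real (f n) \<and> real (f n) < y * ?N"
      then have "(real (f n) / ?N, real n / ?N) \<in> B \<inter> P"
        using that N by (auto simp: B P field_simps)
      then show False using BP by blast
    qed
    from empty_box_area_le[OF f b m sc[OF uv] sc[OF xy] this] show ?thesis
      by (simp add: algebra_simps power2_eq_square)
  qed
  then have "(y - x) * (v - u) \<le> (2 * real b * ?N - real b ^ 2) / ?N ^ 2"
    using N by (simp add: pos_le_divide_eq)
  also have "\<dots> = 2 * real b / ?N * (1 - real b / (2 * ?N))"
    using N by (simp add: field_simps power2_eq_square)
  finally have "(y - x) * (v - u) \<le> 2 * real b / ?N * (1 - real b / (2 * ?N))" .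
  moreover have "measure lborel B = (y - x) * (v - u)"
  proof -
    have "emeasure (lborel \<Otimes>\<^sub>M lborel) ({x..<y} \<times> {u..<v}) =
        emeasure lborel {x..<y} * emeasure lborel {u..<v}"
      by (rule lborel.emeasure_pair_measure_Times) auto
    also have "\<dots> = ennreal ((y - x) * (v - u))" using xy uv by (simp add: ennreal_mult)
    finally show ?thesis unfolding B measure_def lborel_prod using xy uv by simp
  qed
  ultimately show "measure lborel B \<le> 2 * real b / ?N * (1 - real b / (2 * ?N))" by simp
qed

section \<open>Coordinates of digital nets\<close>

definition coord_digit ::
  "nat \<Rightarrow> nat \<Rightarrow> (nat \<Rightarrow> 'k::field) \<Rightarrow> 'k Matrix.mat \<Rightarrow> nat \<Rightarrow> nat \<Rightarrow> nat" where
  "coord_digit b m \<phi> C n i =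
     the_inv_into {..<b} \<phi> (vec_index (mult_mat_vec C (digit_vec b m \<phi> n)) i)"

definition coord_numerator ::
  "nat \<Rightarrow> nat \<Rightarrow> (nat \<Rightarrow> 'k::field) \<Rightarrow> 'k Matrix.mat \<Rightarrow> nat \<Rightarrow> nat" where
  "coord_numerator b m \<phi> C n = radix_value b (coord_digit b m \<phi> C n) m"

lemma net_coord_eq:
  assumes "b > 0"
  shows "net_coord b m \<phi> C n = real (coord_numerator b m \<phi> C n) / real b ^ m"
  unfolding net_coord_def coord_numerator_def coord_digit_def[symmetric]
  by (rule radix_value_sum[OF assms])

lemma mult_mat_vec_entry:
  assumes "C \<in> carrier_mat m m" "i < m"
  shows "vec_index (mult_mat_vec C (digit_vec b m \<phi> n)) i =
    (\<Sum>l<m. index_mat C (i, l) * \<phi> (n div b ^ l mod b))"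
  using assms by (simp add: digit_vec_def scalar_prod_def atLeast0LessThan)

context
  fixes b m :: nat and \<phi> :: "nat \<Rightarrow> 'k::field"
  assumes b: "b \<ge> 2" and \<phi>: "bij_betw \<phi> {..<b} UNIV"
begin

lemma coord_digit_less: "coord_digit b m \<phi> C n i < b"
  using the_inv_into_into[of \<phi> "{..<b}" _ "{..<b}"] \<phi>
  unfolding coord_digit_def bij_betw_def by auto

lemma coord_digit_eq_iff:
  "coord_digit b m \<phi> C n i = coord_digit b m \<phi> C n' i \<longleftrightarrow>
   vec_index (mult_mat_vec C (digit_vec b m \<phi> n)) i =
   vec_index (mult_mat_vec C (digit_vec b m \<phi> n')) i"
  using \<phi> unfolding coord_digit_def bij_betw_def
  by (metis UNIV_I f_the_inv_into_f)

text \<open>The anti-diagonal matrix undoes the opposite digit orders of \<open>n\<close> (lowest digit first) and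
  of coordinates (highest digit first), and \<open>\<phi>\<close> cancels against its inverse.\<close>

lemma coord_numerator_J:
  assumes "n < b ^ m"
  shows "coord_numerator b m \<phi> (J m) n = n"
proof -
  have "coord_digit b m \<phi> (J m) n i = n div b ^ (m - Suc i) mod b" if i: "i < m" for i
  proof -
    have "vec_index (mult_mat_vec (J m) (digit_vec b m \<phi> n)) i =
        (\<Sum>l<m. index_mat (J m) (i, l) * \<phi> (n div b ^ l mod b))"
      by (rule mult_mat_vec_entry) (auto simp: J_def i)
    also have "\<dots> = (\<Sum>l<m. if l = m - Suc i then \<phi> (n div b ^ l mod b) else 0)"
      using i by (intro sum.cong) (auto simp: J_def)
    also have "\<dots> = \<phi> (n div b ^ (m - Suc i) mod b)" using i by simp
    finally show ?thesis
      using \<phi> b unfolding coord_digit_def bij_betw_def by (simp add: the_inv_into_f_f)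
  qed
  then have "coord_numerator b m \<phi> (J m) n = radix_value b (\<lambda>i. n div b ^ (m - Suc i) mod b) m"
    unfolding coord_numerator_def by (intro radix_value_cong) auto
  also have "\<dots> = n" using radix_value_digits[OF assms, of m] by simp
  finally show ?thesis .
qed

lemma digital_net_J:
  "digital_net b m \<phi> (J m) C =
   (\<lambda>n. (real n / real b ^ m, real (coord_numerator b m \<phi> C n) / real b ^ m)) ` {..<b ^ m}"
  unfolding digital_net_def using b by (intro image_cong) (auto simp: net_coord_eq coord_numerator_J)

lemma coord_numerator_bij:
  assumes C: "C \<in> carrier_mat m m" and "invertible_mat C"
  shows "bij_betw (coord_numerator b m \<phi> C) {..<b ^ m} {..<b ^ m}"
proof -
  obtain D where D: "inverts_mat C D" "inverts_mat D C"
    using assms(2) by (auto simp: invertible_mat_def)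
  have CD: "C * D = Matrix.one_mat m" and DC': "D * C = Matrix.one_mat (dim_row D)"
    using D C by (auto simp: inverts_mat_def)
  have "dim_row D = m" using arg_cong[OF DC', of dim_col] C by simp
  moreover have "dim_col D = m" using arg_cong[OF CD, of dim_col] by simp
  ultimately have Dm: "D \<in> carrier_mat m m" and DC: "D * C = Matrix.one_mat m"
    using DC' by auto
  have "inj_on (coord_numerator b m \<phi> C) {..<b ^ m}"
  proof (rule inj_onI)
    fix n n' assume nn: "n \<in> {..<b ^ m}" "n' \<in> {..<b ^ m}"
      and eq: "coord_numerator b m \<phi> C n = coord_numerator b m \<phi> C n'"
    let ?v = "digit_vec b m \<phi>"
    have v: "?v n \<in> carrier_vec m" for n by (simp add: digit_vec_def)
    have "coord_digit b m \<phi> C n i = coord_digit b m \<phi> C n' i" if "i < m" for i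
      using radix_value_inj[OF eq[unfolded coord_numerator_def]] that coord_digit_less by blast
    then have "mult_mat_vec C (?v n) = mult_mat_vec C (?v n')"
      using C by (intro eq_vecI) (auto simp: coord_digit_eq_iff)
    then have "mult_mat_vec (D * C) (?v n) = mult_mat_vec (D * C) (?v n')"
      using assoc_mult_mat_vec[OF Dm C v] by simp
    then have veq: "?v n = ?v n'" using v by (simp add: DC)
    show "n = n'"
    proof (rule digits_determine)
      fix i assume "i < m"
      then have "\<phi> (n div b ^ i mod b) = \<phi> (n' div b ^ i mod b)"
        using arg_cong[OF veq, of "\<lambda>v. vec_index v i"] by (simp add: digit_vec_def)
      then show "n div b ^ i mod b = n' div b ^ i mod b"
        using \<phi> b by (auto simp: bij_betw_def dest: inj_onD)
    qed (use nn in auto)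
  qed
  moreover have "coord_numerator b m \<phi> C ` {..<b ^ m} \<subseteq> {..<b ^ m}"
    unfolding coord_numerator_def using radix_value_less coord_digit_less by blast
  ultimately show ?thesis by (simp add: bij_betw_def endo_inj_surj)
qed

text \<open>Row \<open>i\<close> of an upper triangular matrix only involves the digits of weight at least
  \<open>b ^ i\<close>, and for \<open>i \<ge> j\<close> these are constant on an aligned block of length \<open>b ^ j\<close>.\<close>

lemma upper_triangular_spreads_blocks:
  assumes C: "C \<in> carrier_mat m m" "invertible_mat C" "upper_triangular C"
  shows "spreads_blocks b m (coord_numerator b m \<phi> C)"
  unfolding spreads_blocks_def
proof (intro conjI allI impI)
  show "bij_betw (coord_numerator b m \<phi> C) {..<b ^ m} {..<b ^ m}"
    using C by (intro coord_numerator_bij)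
  fix j n n' assume j: "j \<le> m" and eq: "n div b ^ j = n' div b ^ j"
  have "coord_digit b m \<phi> C n i = coord_digit b m \<phi> C n' i" if i: "j \<le> i" "i < m" for i
  proof -
    have "index_mat C (i, l) * \<phi> (n div b ^ l mod b) = index_mat C (i, l) * \<phi> (n' div b ^ l mod b)"
      for l
    proof (cases "l < i")
      case True
      then show ?thesis using C i by auto
    next
      case False
      then show ?thesis using high_digits_eq[OF eq, of l] i by simp
    qed
    then show ?thesis
      unfolding coord_digit_eq_iff mult_mat_vec_entry[OF C(1) i(2)] by (intro sum.cong refl)
  qed
  then show "coord_numerator b m \<phi> C n mod b ^ (m - j) = coord_numerator b m \<phi> C n' mod b ^ (m - j)"
    using radix_value_mod_cong[of j "m - j" "coord_digit b m \<phi> C n" "coord_digit b m \<phi> C n'" b] j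
    unfolding coord_numerator_def by simp
qed

text \<open>For a lower triangular matrix the \<open>m - j\<close> leading digits of the image depend only on the
  \<open>m - j\<close> lowest digits of \<open>n\<close>. Because the matrix is invertible, every value of the leading
  digits arises, and a surjection between finite sets of equal size is injective: the leading
  digits of the image determine the lowest digits of \<open>n\<close>, which is the required property of the
  inverse permutation.\<close>

lemma lower_triangular_inverse_spreads_blocks:
  assumes C: "C \<in> carrier_mat m m" "invertible_mat C" "lower_triangular C"
  shows "spreads_blocks b m (the_inv_into {..<b ^ m} (coord_numerator b m \<phi> C))"
  unfolding spreads_blocks_def
proof (intro conjI allI impI)
  let ?A = "coord_numerator b m \<phi> C"
  let ?g = "the_inv_into {..<b ^ m} ?A"
  have bij: "bij_betw ?A {..<b ^ m} {..<b ^ m}" using C by (intro coord_numerator_bij)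
  then show "bij_betw ?g {..<b ^ m} {..<b ^ m}" by (rule bij_betw_the_inv_into)
  fix j z z' assume j: "j \<le> m" and z: "z < b ^ m" "z' < b ^ m" and eq: "z div b ^ j = z' div b ^ j"
  let ?K = "b ^ (m - j)"
  have N: "b ^ m = ?K * b ^ j" using j by (simp flip: power_add)
  have det: "?A n div b ^ j = ?A n' div b ^ j" if nn: "n mod ?K = n' mod ?K" for n n'
  proof -
    have "coord_digit b m \<phi> C n i = coord_digit b m \<phi> C n' i" if i: "i < m - j" for i
    proof -
      have im: "i < m" using i by simp
      have "index_mat C (i, l) * \<phi> (n div b ^ l mod b) =
          index_mat C (i, l) * \<phi> (n' div b ^ l mod b)" if "l < m" for l
      proof (cases "i < l")
        case True
        then show ?thesis using C im that by (auto simp: lower_triangular_def)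
      next
        case False
        then show ?thesis using low_digits_eq[OF nn, of l] i by simp
      qed
      then show ?thesis
        unfolding coord_digit_eq_iff mult_mat_vec_entry[OF C(1) im] by (intro sum.cong refl) auto
    qed
    then have "radix_value b (coord_digit b m \<phi> C n) (m - j) =
        radix_value b (coord_digit b m \<phi> C n') (m - j)"
      by (intro radix_value_cong)
    then show ?thesis
      using radix_value_div[of "m - j" j "coord_digit b m \<phi> C _" b] coord_digit_less j
      unfolding coord_numerator_def by simp
  qed
  have "{..<?K} \<subseteq> (\<lambda>r. ?A r div b ^ j) ` {..<?K}"
  proof
    fix q assume "q \<in> {..<?K}"
    then have "q * b ^ j < b ^ m" using b by (simp add: N)
    then obtain n where n: "?A n = q * b ^ j" using bij by (metis bij_betw_imp_surj_on imageE lessThan_iff)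
    have "?A (n mod ?K) div b ^ j = ?A n div b ^ j" by (rule det) simp
    also have "\<dots> = q" using n b by simp
    finally show "q \<in> (\<lambda>r. ?A r div b ^ j) ` {..<?K}" using b by force
  qed
  moreover have "?A r div b ^ j < ?K" if "r < b ^ m" for r
    using bij that by (auto simp: N less_mult_imp_div_less dest: bij_betwE)
  moreover have "?K \<le> b ^ m" using b by (intro power_increasing) auto
  ultimately have "(\<lambda>r. ?A r div b ^ j) ` {..<?K} = {..<?K}" by force
  then have inj: "inj_on (\<lambda>r. ?A r div b ^ j) {..<?K}" by (intro eq_card_imp_inj_on) auto
  have A_g: "?A (?g z) = z" if "z < b ^ m" for z
    using bij that by (simp add: bij_betw_def f_the_inv_into_f)
  have "?A (?g z mod ?K) div b ^ j = z div b ^ j" if "z < b ^ m" for z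
    using det[of "?g z mod ?K" "?g z"] A_g[OF that] by simp
  then have "?A (?g z mod ?K) div b ^ j = ?A (?g z' mod ?K) div b ^ j" using z eq by simp
  then show "?g z mod ?K = ?g z' mod ?K" using inj b by (auto dest: inj_onD)
qed

end

theorem theorem3p2:
  fixes b m :: nat
    and \<phi> :: "nat \<Rightarrow> 'k::field"
    and P :: "(real \<times> real) set"
  assumes "prime b"
    and "CARD('k) = b"
    and "bij_betw \<phi> {..<b} UNIV"
    and "m \<ge> 1"
    and "digital_0m2_net b m \<phi> P"
    and "NUT_net b m \<phi> P \<or> NLT_net b m \<phi> P"
  shows "disp P \<le> 2 * real b / real b ^ m * (1 - real b / (2 * real b ^ m))"
proof -
  have b: "b \<ge> 2" using assms(1) by (rule prime_ge_2_nat)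
  note net = digital_net_J[OF b assms(3)]
  from assms(6) show ?thesis
  proof
    assume "NUT_net b m \<phi> P"
    then obtain C where "C \<in> carrier_mat m m" "invertible_mat C" "upper_triangular C"
      and P: "P = digital_net b m \<phi> (J m) C" by (auto simp: NUT_net_def)
    then show ?thesis
      using upper_triangular_spreads_blocks[OF b assms(3)] b assms(4)
      by (intro disp_le[of b m "coord_numerator b m \<phi> C"]) (auto simp: net)
  next
    assume "NLT_net b m \<phi> P"
    then obtain C where C: "C \<in> carrier_mat m m" "invertible_mat C" "lower_triangular C"
      and P: "P = digital_net b m \<phi> (J m) C" by (auto simp: NLT_net_def)
    let ?A = "coord_numerator b m \<phi> C"
    let ?g = "the_inv_into {..<b ^ m} ?A"
    have bij: "bij_betw ?A {..<b ^ m} {..<b ^ m}" by (rule coord_numerator_bij[OF b assms(3) C(1,2)])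
    have "P = (\<lambda>n. (real n / real b ^ m, real (?A n) / real b ^ m)) ` {..<b ^ m}"
      unfolding P net ..
    also have "\<dots> = (\<lambda>n. (real (?g (?A n)) / real b ^ m, real (?A n) / real b ^ m)) ` {..<b ^ m}"
      using bij by (intro image_cong) (auto simp: bij_betw_def the_inv_into_f_f)
    also have "\<dots> = (\<lambda>z. (real (?g z) / real b ^ m, real z / real b ^ m)) ` ?A ` {..<b ^ m}"
      by (simp add: image_image)
    also have "?A ` {..<b ^ m} = {..<b ^ m}" using bij by (rule bij_betw_imp_surj_on)
    finally show ?thesis
      using lower_triangular_inverse_spreads_blocks[OF b assms(3) C] b assms(4)
      by (intro disp_le[of b m ?g]) auto
  qed
qed

end
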